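(* Let $e\in\mathbb{R}$ with $e\geq f(y_n,x_n)$ for all $n\in\mathbb{N}$ and let $M>0$ with $M\geq\lVert\xi_n\rVert$ for all $n\in\mathbb{N}$. Let $\lambda_n\in[a,b]\subseteq(0,2/M^2)$ for all $n\in\mathbb{N}$ and let $L\geq\mathrm{diam}\{x_n\mid n\in\mathbb{N}\}$ ($L\in\mathbb{R}$). Let $\varepsilon_n\geq 0$, $\varepsilon_n\to 0$ $(n\to\infty)$ and let $\tau:\mathbb{N}\to\mathbb{N}$ be a nondecreasing rate of convergence for $\varepsilon_n\to 0$. Let $u\in\Omega\neq\emptyset$ with $c_u\geq\lVert x_0-u\rVert^2$. Then for all $k\in\mathbb{N}$ and all $g:\mathbb{N}\to\mathbb{N}$: \[ \exists n\leq\Sigma(k,g)\ \forall i,j\in[n;n+g(n)]\ \left(\lVert x_i-x_j\rVert\leq\frac{1}{k+1}\right), \] where $\Sigma(k,g):=\Sigma_0(P(k),k,g,\chi,\Phi)$ with \[ P(k):=\left\lceil(8k+8)\sqrt{N}L\right\rceil^N, \] \[ \Sigma_0(0,k,g,\chi,\Phi):=0,\qquad \Sigma_0(n+1,k,g,\chi,\Phi):=\Phi\left(\chi_g^{\max}(\Sigma_0(n,k,g,\chi,\Phi),4k+3)\right), \] \[ \chi(n,m,r):=\max\left\{n+m,\left\lfloor(r+1)^2m^2\beta(b,e,M)\right\rfloor\right\}, \] \[ \chi_g(n,k):=\chi(n,g(n),k),\qquad \chi_g^{\max}(n,k):=\max\{\chi_g(i,k)\mid i\leq n\}, \] \[ \Phi(k):=2\left\lceil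 c_u\cdot(\sigma(a,b,M,L))^4\,16(k+1)^4\right\rceil+\max\{k,\tau(2k+1)\}+1, \] \[ \alpha(a,b,M):=-a(M^2b-2),\qquad \beta(b,e,M):=\left(1+\sqrt{2be(1+M)}\right)^2, \] \[ \sigma(a,b,M,L):=\left\lceil\frac{\sqrt{2MbL}}{\sqrt[4]{\alpha(a,b,M)}}+\frac{Mb+1}{\sqrt{\alpha(a,b,M)}}+1\right\rceil. \]
   Context: Notation: $\mathbb{N}=\{0,1,2,\dots\}$, $[n;m]:=\{n,n+1,\dots,m\}$. $\mathbb{R}^N$ ($N\geq1$) carries the Euclidean inner product and norm; $\overline{B_r(x)}$ is the closed ball. Setting: $f:\mathbb{R}^N\times\mathbb{R}^N\to\mathbb{R}$ satisfies: $f(x,x)=0$ for all $x$; $f(\cdot,y)$ is continuous for every $y$; $f(x,\cdot)$ is convex for every $x$. $T:\mathbb{R}^N\to\mathbb{R}^N$ is firmly nonexpansive, i.e. $\lVert Tx-Ty\rVert^2\leq\langle x-y,Tx-Ty\rangle$ for all $x,y$, with nonempty fixed point set $\mathrm{Fix}(T)$. The sequences are generated by the following algorithm: $x_0\in\mathbb{R}^N$ is arbitrary, $\rho_0:=\lVert x_0\rVert$. Given $x_n$ and $\rho_n$, choose $\varepsilon_n\geq0$ and $\lambda_n>0$; take $y_n\in K_n:=\overline{B_{\rho_n+1}(0)}$ with $f(y_n,x_n)\geq0$ and $\max_{y\in K_n}f(y,x_n)\leq f(y_n,x_n)+\varepsilon_n$; choose any $\xi_n\in\partial f(y_n,\cdot)(x_n)$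 (subdifferential of the convex function $f(y_n,\cdot)$ at $x_n$); set $x_{n+1}:=T(x_n-\lambda_nf(y_n,x_n)\xi_n)$ and $\rho_{n+1}:=\max\{\rho_n,\lVert x_{n+1}\rVert\}$. $\Omega_n:=\{u\in\mathrm{Fix}(T)\mid f(y_n,u)\leq0\}$ and $\Omega:=\bigcap_{n\in\mathbb{N}}\Omega_n$. A nondecreasing rate of convergence for $\varepsilon_n\to0$ is a function $\tau:\mathbb{N}\to\mathbb{N}$ with $\tau(k+1)\geq\tau(k)$ and $\varepsilon_n\leq\frac1{k+1}$ for all $k\in\mathbb{N}$ and $n\geq\tau(k)$. *)

theory Defs
  imports "HOL-Analysis.Analysis"
begin

definition equilibrium_bifunction :: "('a::euclidean_space \<Rightarrow> 'a \<Rightarrow> real) \<Rightarrow> bool" where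
  "equilibrium_bifunction f \<longleftrightarrow>
     (\<forall>x. f x x = 0) \<and>
     (\<forall>y. continuous_on UNIV (\<lambda>x. f x y)) \<and>
     (\<forall>x. convex_on UNIV (f x))"

definition firmly_nonexpansive :: "('a::real_inner \<Rightarrow> 'a) \<Rightarrow> bool" where
  "firmly_nonexpansive T \<longleftrightarrow>
     (\<forall>x y. (norm (T x - T y))\<^sup>2 \<le> (x - y) \<bullet> (T x - T y))"

definition Fixpoints :: "('a \<Rightarrow> 'a) \<Rightarrow> 'a set" where
  "Fixpoints T = {x. T x = x}"

definition subdifferential :: "('a::real_inner \<Rightarrow> real) \<Rightarrow> 'a \<Rightarrow> 'a set" where
  "subdifferential h x = {\<xi>. \<forall>z. h x + \<xi> \<bullet> (z - x) \<le> h z}"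

text \<open>The algorithm leaves free the starting point, the parameters \<open>\<epsilon>\<close> and \<open>\<lambda>\<close>, and the choice of
  \<open>y\<close> and \<open>\<xi>\<close>; it is therefore a relation between sequences. For a bifunction that is continuous
  in its first argument, the supremum below ranges over a nonempty compact set and is attained,
  i.e. it is the maximum.\<close>

definition generated_by_algorithm ::
  "('a::euclidean_space \<Rightarrow> 'a \<Rightarrow> real) \<Rightarrow> ('a \<Rightarrow> 'a) \<Rightarrow> (nat \<Rightarrow> real) \<Rightarrow> (nat \<Rightarrow> real) \<Rightarrow>
   (nat \<Rightarrow> 'a) \<Rightarrow> (nat \<Rightarrow> real) \<Rightarrow> (nat \<Rightarrow> 'a) \<Rightarrow> (nat \<Rightarrow> 'a) \<Rightarrow> bool" where
  "generated_by_algorithm f T \<epsilon> lam x \<rho> y \<xi> \<longleftrightarrow>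
     \<rho> 0 = norm (x 0) \<and>
     (\<forall>n. 0 \<le> \<epsilon> n \<and> 0 < lam n \<and>
        y n \<in> cball 0 (\<rho> n + 1) \<and>
        0 \<le> f (y n) (x n) \<and>
        (SUP z\<in>cball 0 (\<rho> n + 1). f z (x n)) \<le> f (y n) (x n) + \<epsilon> n \<and>
        \<xi> n \<in> subdifferential (f (y n)) (x n) \<and>
        x (Suc n) = T (x n - (lam n * f (y n) (x n)) *\<^sub>R \<xi> n) \<and>
        \<rho> (Suc n) = max (\<rho> n) (norm (x (Suc n))))"

definition Omega_at ::
  "('a \<Rightarrow> 'a \<Rightarrow> real) \<Rightarrow> ('a \<Rightarrow> 'a) \<Rightarrow> (nat \<Rightarrow> 'a) \<Rightarrow> nat \<Rightarrow> 'a set" where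
  "Omega_at f T y n = {u \<in> Fixpoints T. f (y n) u \<le> 0}"

definition Omega :: "('a \<Rightarrow> 'a \<Rightarrow> real) \<Rightarrow> ('a \<Rightarrow> 'a) \<Rightarrow> (nat \<Rightarrow> 'a) \<Rightarrow> 'a set" where
  "Omega f T y = (\<Inter>n. Omega_at f T y n)"

definition nondecreasing_rate :: "(nat \<Rightarrow> nat) \<Rightarrow> (nat \<Rightarrow> real) \<Rightarrow> bool" where
  "nondecreasing_rate \<tau> \<epsilon> \<longleftrightarrow>
     (\<forall>k. \<tau> k \<le> \<tau> (k + 1)) \<and>
     (\<forall>k n. \<tau> k \<le> n \<longrightarrow> \<epsilon> n \<le> 1 / (real k + 1))"

text \<open>In the definitions below, \<open>nat\<close> is only applied to integers that are nonnegative for the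
  parameters of interest (\<open>0 < a \<le> b < 2 / M\<^sup>2\<close>, \<open>M > 0\<close> and \<open>e, L, c \<ge> 0\<close>), so it never truncates.\<close>

definition alpha_const :: "real \<Rightarrow> real \<Rightarrow> real \<Rightarrow> real" where
  "alpha_const a b M = - a * (M\<^sup>2 * b - 2)"

definition beta_const :: "real \<Rightarrow> real \<Rightarrow> real \<Rightarrow> real" where
  "beta_const b e M = (1 + sqrt (2 * b * e * (1 + M)))\<^sup>2"

definition sigma_const :: "real \<Rightarrow> real \<Rightarrow> real \<Rightarrow> real \<Rightarrow> nat" where
  "sigma_const a b M L =
     nat \<lceil>sqrt (2 * M * b * L) / root 4 (alpha_const a b M)
          + (M * b + 1) / sqrt (alpha_const a b M) + 1\<rceil>"

definition P_bound :: "nat \<Rightarrow> real \<Rightarrow> nat \<Rightarrow> nat" where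
  "P_bound N L k = (nat \<lceil>(8 * real k + 8) * sqrt (real N) * L\<rceil>) ^ N"

definition chi :: "real \<Rightarrow> real \<Rightarrow> real \<Rightarrow> nat \<Rightarrow> nat \<Rightarrow> nat \<Rightarrow> nat" where
  "chi b e M n m r =
     max (n + m) (nat \<lfloor>(real r + 1)\<^sup>2 * (real m)\<^sup>2 * beta_const b e M\<rfloor>)"

definition Phi ::
  "real \<Rightarrow> real \<Rightarrow> real \<Rightarrow> real \<Rightarrow> real \<Rightarrow> (nat \<Rightarrow> nat) \<Rightarrow> nat \<Rightarrow> nat" where
  "Phi a b M L c \<tau> k =
     2 * nat \<lceil>c * (real (sigma_const a b M L)) ^ 4 * 16 * (real k + 1) ^ 4\<rceil>
     + max k (\<tau> (2 * k + 1)) + 1"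

definition chi_g :: "(nat \<Rightarrow> nat \<Rightarrow> nat \<Rightarrow> nat) \<Rightarrow> (nat \<Rightarrow> nat) \<Rightarrow> nat \<Rightarrow> nat \<Rightarrow> nat" where
  "chi_g X g n k = X n (g n) k"

definition chi_g_max :: "(nat \<Rightarrow> nat \<Rightarrow> nat \<Rightarrow> nat) \<Rightarrow> (nat \<Rightarrow> nat) \<Rightarrow> nat \<Rightarrow> nat \<Rightarrow> nat" where
  "chi_g_max X g n k = Max {chi_g X g i k | i. i \<le> n}"

primrec Sigma0 ::
  "nat \<Rightarrow> nat \<Rightarrow> (nat \<Rightarrow> nat) \<Rightarrow> (nat \<Rightarrow> nat \<Rightarrow> nat \<Rightarrow> nat) \<Rightarrow> (nat \<Rightarrow> nat) \<Rightarrow> nat" where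
  "Sigma0 0 k g X F = 0"
| "Sigma0 (Suc n) k g X F = F (chi_g_max X g (Sigma0 n k g X F) (4 * k + 3))"

end

theory Submission
  imports Defs
begin

text \<open>
  Call \<open>q\<close> a \<open>k\<close>-approximate solution if \<open>q\<close> is moved by \<open>T\<close> by at most \<open>1 / (k + 1)\<close> and
  \<open>f (y i) q \<le> 1 / (k + 1)\<close> for all \<open>i \<le> k\<close>. Only finitely many of the points \<open>y i\<close> are tested, so that
  the run can reach such a \<open>q\<close> by a known index. The rate rests on three facts.

  First, \<open>Phi k\<close> bounds the index of some iterate that is a \<open>k\<close>-approximate solution
  (\<open>approx_solution_bound\<close>). For \<open>u\<close> in \<open>Omega\<close>, the squared distance of the iterates to \<open>u\<close> drops in each
  step by a quantity that controls \<open>f (y n) (x n)\<close> and the displacement made by \<open>T\<close>; the total drop is at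
  most \<open>c\<close>, so any long enough block of steps contains one with a small drop. If this step comes late,
  \<open>f (y i) (x n)\<close> is small for all earlier \<open>i\<close> as well, because \<open>y n\<close> nearly maximises \<open>f\<close> over a ball that
  contains \<open>y i\<close>.

  Second, \<open>chi\<close> is a modulus of Fejer monotonicity (\<open>Fejer_modulus\<close>): if \<open>q\<close> is a sufficiently good
  approximate solution, \<open>m\<close> further steps increase the distance to \<open>q\<close> by at most \<open>1 / (r + 1)\<close>.

  Third, unless \<open>L = 0\<close>, among more than \<open>P_bound\<close> iterates two lie within \<open>1 / (4 k + 4)\<close> of each other
  (\<open>two_points_close\<close>), by placing the iterates into small cubes.

  These are combined in any metric space (\<open>metastable_if_approximately_Fejer_monotone\<close>). Iterating the first
  fact selects \<open>P\<close> iterates besides \<open>x 0\<close>, each an approximate solution so good that all iterates selected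
  before it stay almost Fejer monotone towards it on their whole interval \<open>{n..n + g n}\<close>. If the earlier of two
  close selected iterates has index \<open>n\<close>, the sequence remains on \<open>{n..n + g n}\<close> near the later one,
  which bounds all mutual distances there.
\<close>

section \<open>A pigeonhole principle in Euclidean space\<close>

text \<open>The points lie in a cube of side \<open>L\<close>, which is cut into cells of side \<open>\<delta> / sqrt N\<close> and hence of
  diameter \<open>\<delta>\<close>; there are no more cells than the bound on \<open>t\<close>, and one more point than that.\<close>

lemma two_points_close:
  fixes p :: "nat \<Rightarrow> real ^ 'n"
  assumes L: "L > 0" and \<delta>: "\<delta> > 0" and dist: "\<And>s t. dist (p s) (p t) \<le> L"
  shows "\<exists>s t. s < t \<and> t \<le> nat \<lceil>2 * sqrt CARD('n) * L / \<delta>\<rceil> ^ CARD('n) \<and> dist (p s) (p t) \<le> \<delta>"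
proof -
  define w where "w = \<delta> / sqrt CARD('n)"
  define D where "D = nat \<lceil>2 * sqrt CARD('n) * L / \<delta>\<rceil>"
  have sqrt_pos: "sqrt CARD('n) > 0" by simp
  have w: "w > 0" unfolding w_def using \<delta> sqrt_pos by simp
  have D_ge: "real D \<ge> 2 * (L / w)"
  proof -
    have "2 * (L / w) = 2 * sqrt CARD('n) * L / \<delta>" by (simp add: w_def)
    then show ?thesis unfolding D_def using real_nat_ceiling_ge by metis
  qed
  \<comment> \<open>Cells of width w cut an interval of length L into at most floor (L / w) + 1 pieces; the factor 2
    in D absorbs the summand 1 once L reaches w, and for smaller L one piece is enough.\<close>
  have floor_lt: "nat \<lfloor>r / w\<rfloor> < D" if "0 \<le> r" "r \<le> L" for r
  proof (cases "L < w")
    case True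
    then have "\<lfloor>r / w\<rfloor> = 0" using that w by (simp add: floor_eq_iff divide_simps)
    moreover have "0 < L / w" using L w by (rule divide_pos_pos)
    then have "0 < real D" using D_ge by linarith
    ultimately show ?thesis by simp
  next
    case False
    then have "L / w \<ge> 1" using w by simp
    moreover have "r / w \<le> L / w" using that w by (simp add: divide_right_mono)
    moreover have "real (nat \<lfloor>r / w\<rfloor>) \<le> r / w" using that w by (simp add: of_nat_floor)
    ultimately have "real (nat \<lfloor>r / w\<rfloor>) < real D" using D_ge by linarith
    then show ?thesis by simp
  qed
  define m where "m i = (INF s. p s $ i)" for i
  have comp: "\<bar>p s $ i - p t $ i\<bar> \<le> L" for s t i
    using component_le_norm_cart[of "p s - p t" i] dist[of s t] by (simp add: dist_norm)
  have bdd: "bdd_below (range (\<lambda>s. p s $ i))" for i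
    by (rule bdd_belowI2[of _ "p 0 $ i - L"]) (use comp[of 0] in \<open>simp add: abs_le_iff algebra_simps\<close>)
  have m_lower: "m i \<le> p s $ i" for s i
    unfolding m_def using bdd by (rule cINF_lower) simp
  have m_upper: "p s $ i - m i \<le> L" for s i
  proof -
    have "p s $ i - L \<le> m i" unfolding m_def
    proof (rule cINF_greatest)
      show "p s $ i - L \<le> p t $ i" for t using comp[of s i t] by linarith
    qed simp
    then show ?thesis by simp
  qed
  define cell where "cell s = (\<lambda>i. nat \<lfloor>(p s $ i - m i) / w\<rfloor>)" for s
  have sub: "cell ` {..D ^ CARD('n)} \<subseteq> (\<Pi>\<^sub>E i\<in>UNIV. {..<D})"
    using floor_lt m_lower m_upper by (auto simp: cell_def)
  have "card (cell ` {..D ^ CARD('n)}) \<le> card (\<Pi>\<^sub>E i\<in>(UNIV :: 'n set). {..<D})"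
    by (rule card_mono[OF _ sub]) (simp add: finite_PiE)
  also have "\<dots> = D ^ CARD('n)" by (simp add: card_PiE)
  finally have "\<not> inj_on cell {..D ^ CARD('n)}"
    using pigeonhole[of cell "{..D ^ CARD('n)}"] by simp
  then obtain s t where st: "s < t" "t \<le> D ^ CARD('n)" "cell s = cell t"
    unfolding inj_on_def by (metis atMost_iff linorder_neqE_nat)
  have coord: "\<bar>p s $ i - p t $ i\<bar> \<le> w" for i
  proof -
    have "nat \<lfloor>(p s $ i - m i) / w\<rfloor> = nat \<lfloor>(p t $ i - m i) / w\<rfloor>"
      using st(3) by (simp add: cell_def fun_eq_iff)
    moreover have "0 \<le> (p s $ i - m i) / w" "0 \<le> (p t $ i - m i) / w"
      using m_lower w by (auto intro!: divide_nonneg_pos)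
    ultimately have "\<lfloor>(p s $ i - m i) / w\<rfloor> = \<lfloor>(p t $ i - m i) / w\<rfloor>"
      by (metis eq_nat_nat_iff zero_le_floor)
    then have "\<bar>(p s $ i - m i) / w - (p t $ i - m i) / w\<bar> \<le> 1" by linarith
    then show ?thesis using w by (simp add: diff_divide_distrib[symmetric] abs_divide)
  qed
  have "dist (p s) (p t) \<le> sqrt CARD('n) * w"
  proof -
    have "(dist (p s) (p t))\<^sup>2 = (\<Sum>i\<in>UNIV. (p s $ i - p t $ i)\<^sup>2)"
      by (simp add: dist_norm norm_vec_def L2_set_def sum_nonneg)
    also have "\<dots> \<le> (\<Sum>i\<in>(UNIV::'n set). w\<^sup>2)"
      by (rule sum_mono) (use coord w in \<open>simp add: abs_le_square_iff[symmetric]\<close>)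
    also have "\<dots> = (sqrt CARD('n) * w)\<^sup>2" by (simp add: power_mult_distrib)
    finally show ?thesis by (rule power2_le_imp_le) (use w in simp)
  qed
  also have "\<dots> = \<delta>" unfolding w_def by simp
  finally show ?thesis using st unfolding D_def by blast
qed

section \<open>Metastability from approximate Fejer monotonicity\<close>

text \<open>The bounds \<open>S s = Sigma0 s k g X F\<close> are chosen so that the iterate with index \<open>\<nu> (Suc s) \<le> S (Suc s)\<close>
  serves as an approximate solution for every start index up to \<open>S s\<close> simultaneously; this is why the maximum
  over such indices enters \<open>Sigma0\<close>. So any two of the selected iterates can play the roles of start
  and target. An index \<open>i\<close> of the interval then costs \<open>1 / (4 k + 4)\<close> for the distance between these two and
  the same amount for the loss in Fejer monotonicity, and a pair of indices costs twice as much.\<close>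

lemma metastable_if_approximately_Fejer_monotone:
  fixes x :: "nat \<Rightarrow> 'a :: metric_space" and A :: "nat \<Rightarrow> 'a set"
  assumes antimono: "\<And>j k. j \<le> k \<Longrightarrow> A k \<subseteq> A j"
    and approx: "\<And>k. \<exists>n \<le> F k. x n \<in> A k"
    and Fejer: "\<And>n m r q i. q \<in> A (X n m r) \<Longrightarrow> i \<in> {n..n + m} \<Longrightarrow>
      dist (x i) q \<le> dist (x n) q + 1 / (real r + 1)"
    and X_ge: "\<And>n m r. n \<le> X n m r" and F_ge: "\<And>k. k \<le> F k"
    and close: "\<And>p. range p \<subseteq> range x \<Longrightarrow>
      \<exists>s t. s < t \<and> t \<le> P \<and> dist (p s) (p t) \<le> 1 / (4 * real k + 4)"
  shows "\<exists>n \<le> Sigma0 P k g X F. \<forall>i\<in>{n..n + g n}. \<forall>j\<in>{n..n + g n}. dist (x i) (x j) \<le> 1 / (real k + 1)"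
proof -
  define S where "S s = Sigma0 s k g X F" for s
  define K where "K s = chi_g_max X g (S s) (4 * k + 3)" for s
  have S_Suc: "S (Suc s) = F (K s)" for s by (simp add: S_def K_def)
  have K_ge: "X n (g n) (4 * k + 3) \<le> K s" if "n \<le> S s" for n s
    unfolding K_def chi_g_max_def chi_g_def using that by (intro Max_ge) auto
  have "S s \<le> S (Suc s)" for s
    using X_ge[of "S s"] K_ge[of "S s" s] F_ge[of "K s"] unfolding S_Suc by (meson le_refl le_trans)
  then have S_mono: "S s \<le> S t" if "s \<le> t" for s t using that by (rule lift_Suc_mono_le)
  \<comment> \<open>The selection starts with index 0, which is never a target and so need not be an approximate solution.\<close>
  have "\<exists>n. n \<le> S s \<and> (\<forall>t. s = Suc t \<longrightarrow> x n \<in> A (K t))" for s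
    using approx by (cases s) (auto simp: S_Suc)
  then obtain \<nu> where \<nu>: "\<nu> s \<le> S s" "x (\<nu> (Suc t)) \<in> A (K t)" for s t by metis
  obtain s t where st: "s < t" "t \<le> P" "dist (x (\<nu> s)) (x (\<nu> t)) \<le> 1 / (4 * real k + 4)"
    using close[of "\<lambda>s. x (\<nu> s)"] by auto
  obtain t' where t': "t = Suc t'" "s \<le> t'" using st(1) by (cases t) auto
  have "X (\<nu> s) (g (\<nu> s)) (4 * k + 3) \<le> K t'" using \<nu>(1)[of s] S_mono[OF t'(2)] by (intro K_ge) simp
  then have mem: "x (\<nu> t) \<in> A (X (\<nu> s) (g (\<nu> s)) (4 * k + 3))"
    using antimono \<nu>(2)[of t'] t'(1) by blast
  have near: "dist (x i) (x (\<nu> t)) \<le> 1 / (4 * real k + 4) + 1 / (4 * real k + 4)"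
    if "i \<in> {\<nu> s..\<nu> s + g (\<nu> s)}" for i
    using Fejer[OF mem that] st(3) by (simp add: algebra_simps)
  have "dist (x i) (x j) \<le> 1 / (real k + 1)"
    if "i \<in> {\<nu> s..\<nu> s + g (\<nu> s)}" "j \<in> {\<nu> s..\<nu> s + g (\<nu> s)}" for i j
  proof -
    have "dist (x i) (x j) \<le> 4 * (1 / (4 * real k + 4))"
      using near[OF that(1)] near[OF that(2)] dist_triangle2[of "x i" "x j" "x (\<nu> t)"] by linarith
    also have "\<dots> = 1 / (real k + 1)" by (simp add: divide_simps)
    finally show ?thesis .
  qed
  moreover have "\<nu> s \<le> Sigma0 P k g X F"
    using \<nu>(1)[of s] S_mono[of s P] st by (simp add: S_def)
  ultimately show ?thesis by blast
qed

section \<open>One step of the algorithm\<close>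

text \<open>The subgradient inequality at \<open>q\<close> says that moving along \<open>- \<xi>\<close> approaches \<open>q\<close>. With \<open>\<delta> = 0\<close> the estimate
  yields the decrease towards exact solutions; with \<open>\<delta> > 0\<close> it bounds the increase of the distance to
  approximate ones.\<close>

lemma subgradient_step:
  fixes h :: "'a :: real_inner \<Rightarrow> real"
  assumes \<xi>: "\<xi> \<in> subdifferential h p" "norm \<xi> \<le> M" and "0 \<le> h p" "h q \<le> \<delta>" "0 \<le> l"
  shows "(norm (p - (l * h p) *\<^sub>R \<xi> - q))\<^sup>2
    \<le> (norm (p - q))\<^sup>2 - l * (2 - l * M\<^sup>2) * (h p)\<^sup>2 + 2 * l * \<delta> * h p"
proof -
  have "h p + \<xi> \<bullet> (q - p) \<le> h q" using \<xi>(1) by (simp add: subdifferential_def)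
  then have "h p - \<delta> \<le> (p - q) \<bullet> \<xi>"
    using \<open>h q \<le> \<delta>\<close> by (simp add: inner_diff_right inner_diff_left inner_commute)
  then have inner: "(2 * l * h p) * (h p - \<delta>) \<le> (2 * l * h p) * ((p - q) \<bullet> \<xi>)"
    using assms by (intro mult_left_mono) auto
  have "(norm \<xi>)\<^sup>2 \<le> M\<^sup>2" using \<xi>(2) by (simp add: power_mono)
  then have sq: "(l * h p)\<^sup>2 * (norm \<xi>)\<^sup>2 \<le> (l * h p)\<^sup>2 * M\<^sup>2" by (rule mult_left_mono) simp
  have "(norm (p - (l * h p) *\<^sub>R \<xi> - q))\<^sup>2 = (norm ((p - q) - (l * h p) *\<^sub>R \<xi>))\<^sup>2"
    by (simp add: algebra_simps)
  also have "\<dots> = (norm (p - q))\<^sup>2 - (2 * l * h p) * ((p - q) \<bullet> \<xi>) + (l * h p)\<^sup>2 * (norm \<xi>)\<^sup>2"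
    unfolding power2_norm_eq_inner
    by (simp add: inner_diff_left inner_diff_right inner_commute power2_eq_square algebra_simps)
  finally show ?thesis using inner sq by (simp add: power2_eq_square algebra_simps)
qed

lemma firmly_nonexpansive_fixpoint:
  assumes "firmly_nonexpansive T" "T u = u"
  shows "(norm (T z - u))\<^sup>2 + (norm (z - T z))\<^sup>2 \<le> (norm (z - u))\<^sup>2"
proof -
  have "(norm (T z - u))\<^sup>2 \<le> (z - u) \<bullet> (T z - u)"
    using assms unfolding firmly_nonexpansive_def by metis
  then show ?thesis unfolding power2_norm_eq_inner
    by (simp add: inner_diff_left inner_diff_right inner_commute)
qed

lemma firmly_nonexpansive_imp_nonexpansive:
  assumes "firmly_nonexpansive T"
  shows "norm (T p - T q) \<le> norm (p - q)"
proof -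
  have "(norm (T p - T q))\<^sup>2 \<le> norm (p - q) * norm (T p - T q)"
    using assms norm_cauchy_schwarz order_trans unfolding firmly_nonexpansive_def by blast
  then show ?thesis by (cases "T p = T q") (simp_all add: power2_eq_square)
qed

section \<open>The run of the algorithm\<close>

locale algorithm_run =
  fixes f :: "'a::euclidean_space \<Rightarrow> 'a \<Rightarrow> real"
    and T :: "'a \<Rightarrow> 'a"
    and \<epsilon> lam \<rho> :: "nat \<Rightarrow> real"
    and x y \<xi> :: "nat \<Rightarrow> 'a"
    and a b e M :: real
  assumes f: "equilibrium_bifunction f"
    and T: "firmly_nonexpansive T"
    and run: "generated_by_algorithm f T \<epsilon> lam x \<rho> y \<xi>"
    and value_le: "f (y n) (x n) \<le> e"
    and \<xi>_le: "norm (\<xi> n) \<le> M"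
    and M_pos: "M > 0"
    and a_pos: "a > 0"
    and b_less: "b < 2 / M\<^sup>2"
    and lam_ge: "a \<le> lam n"
    and lam_le: "lam n \<le> b"
begin

abbreviation v where "v n \<equiv> f (y n) (x n)"
abbreviation z where "z n \<equiv> x n - (lam n * v n) *\<^sub>R \<xi> n"

lemma value_nonneg: "0 \<le> v n"
  and subgradient: "\<xi> n \<in> subdifferential (f (y n)) (x n)"
  and x_Suc: "x (Suc n) = T (z n)"
  and y_mem: "y n \<in> cball 0 (\<rho> n + 1)"
  and value_near_SUP: "(SUP w\<in>cball 0 (\<rho> n + 1). f w (x n)) \<le> v n + \<epsilon> n"
  and \<rho>_Suc: "\<rho> n \<le> \<rho> (Suc n)"
  using run by (auto simp: generated_by_algorithm_def)

lemma constants: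
  shows b_pos: "b > 0" and e_nonneg: "e \<ge> 0" and bM: "b * M\<^sup>2 < 2"
    and alpha_pos: "alpha_const a b M > 0"
proof -
  show "b > 0" using a_pos lam_ge[of 0] lam_le[of 0] by linarith
  show "e \<ge> 0" using value_nonneg[of 0] value_le[of 0] by linarith
  show "b * M\<^sup>2 < 2" using b_less M_pos by (simp add: divide_simps)
  then have "0 < a * (2 - b * M\<^sup>2)" using a_pos by simp
  then show "alpha_const a b M > 0" by (simp add: alpha_const_def algebra_simps)
qed

definition approx_solutions :: "nat \<Rightarrow> 'a set" where
  "approx_solutions k =
     {q. norm (q - T q) \<le> 1 / (real k + 1) \<and> (\<forall>i\<le>k. f (y i) q \<le> 1 / (real k + 1))}"

lemma approx_solutions_antimono:
  assumes "j \<le> k"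
  shows "approx_solutions k \<subseteq> approx_solutions j"
proof -
  have "1 / (real k + 1) \<le> 1 / (real j + 1)" using assms by (simp add: frac_le)
  then show ?thesis using assms unfolding approx_solutions_def by (auto intro: order_trans)
qed

text \<open>The radii \<open>\<rho> n\<close> never decrease, so \<open>y i\<close> competes in the approximate maximisation that produced \<open>y n\<close>.\<close>

lemma value_at_earlier_point:
  assumes "i \<le> n"
  shows "f (y i) (x n) \<le> v n + \<epsilon> n"
proof -
  have "\<rho> i \<le> \<rho> n" using assms \<rho>_Suc by (rule lift_Suc_mono_le[rotated])
  then have mem: "y i \<in> cball 0 (\<rho> n + 1)" using y_mem[of i] by simp
  have "continuous_on (cball 0 (\<rho> n + 1)) (\<lambda>w. f w (x n))"
    using f continuous_on_subset unfolding equilibrium_bifunction_def by blast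
  then have "bdd_above ((\<lambda>w. f w (x n)) ` cball 0 (\<rho> n + 1))"
    by (intro bounded_imp_bdd_above compact_imp_bounded compact_continuous_image) auto
  then have "f (y i) (x n) \<le> (SUP w\<in>cball 0 (\<rho> n + 1). f w (x n))"
    using mem by (rule cSUP_upper[rotated])
  then show ?thesis using value_near_SUP[of n] by linarith
qed

text \<open>The function \<open>t * (2 - t * M\<^sup>2)\<close> is at least \<open>a * (2 - b * M\<^sup>2)\<close> on \<open>{a..b}\<close>; this is where
  \<open>alpha_const\<close> comes from. The last summand on the left is the additional gain that distinguishes
  firmly nonexpansive from nonexpansive maps.\<close>

lemma energy_decrease:
  assumes "u \<in> Omega f T y"
  shows "(norm (x (Suc n) - u))\<^sup>2 + (alpha_const a b M * (v n)\<^sup>2 + (norm (z n - x (Suc n)))\<^sup>2)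
    \<le> (norm (x n - u))\<^sup>2"
proof -
  have u: "T u = u" "f (y n) u \<le> 0"
    using assms by (auto simp: Omega_def Omega_at_def Fixpoints_def)
  have "a * (2 - b * M\<^sup>2) \<le> lam n * (2 - lam n * M\<^sup>2)"
    using a_pos bM lam_ge[of n] lam_le[of n] by (intro mult_mono) (auto intro: mult_right_mono)
  then have "alpha_const a b M * (v n)\<^sup>2 \<le> lam n * (2 - lam n * M\<^sup>2) * (v n)\<^sup>2"
    by (intro mult_right_mono) (auto simp: alpha_const_def algebra_simps)
  moreover have "(norm (z n - u))\<^sup>2 \<le> (norm (x n - u))\<^sup>2 - lam n * (2 - lam n * M\<^sup>2) * (v n)\<^sup>2"
    using subgradient_step[OF subgradient \<xi>_le value_nonneg u(2), of "lam n"] a_pos lam_ge[of n]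
    by simp
  moreover have "(norm (x (Suc n) - u))\<^sup>2 + (norm (z n - x (Suc n)))\<^sup>2 \<le> (norm (z n - u))\<^sup>2"
    using firmly_nonexpansive_fixpoint[OF T u(1), of "z n"] by (simp add: x_Suc)
  ultimately show ?thesis by linarith
qed

text \<open>By telescoping, all terms together amount to at most \<open>c\<close>, so \<open>l + 1\<close> consecutive ones cannot all exceed
  their fair share.\<close>

lemma small_energy_term:
  assumes u: "u \<in> Omega f T y" and c: "(norm (x 0 - u))\<^sup>2 \<le> c"
  shows "\<exists>n\<ge>m. n \<le> m + l \<and>
    alpha_const a b M * (v n)\<^sup>2 + (norm (z n - x (Suc n)))\<^sup>2 \<le> c / (real l + 1)"
proof (rule ccontr)
  define E where "E n = alpha_const a b M * (v n)\<^sup>2 + (norm (z n - x (Suc n)))\<^sup>2" for n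
  have E_nonneg: "0 \<le> E n" for n using alpha_pos unfolding E_def by simp
  have total: "(norm (x n - u))\<^sup>2 + (\<Sum>i<n. E i) \<le> c" for n
  proof (induction n)
    case (Suc n)
    then show ?case using energy_decrease[OF u, of n] unfolding E_def by simp
  qed (use c in simp)
  assume "\<not> ?thesis"
  then have large: "c / (real l + 1) < E i" if "i \<in> {m..m + l}" for i
    using that unfolding E_def by (meson atLeastAtMost_iff not_le)
  have "c = (\<Sum>i\<in>{m..m + l}. c / (real l + 1))" by (simp add: field_simps)
  also have "\<dots> < (\<Sum>i\<in>{m..m + l}. E i)" using large by (intro sum_strict_mono) auto
  also have "\<dots> \<le> (\<Sum>i<Suc (m + l). E i)" using E_nonneg by (intro sum_mono2) auto
  also have "\<dots> \<le> c"
    using total[of "Suc (m + l)"] zero_le_power2[of "norm (x (Suc (m + l)) - u)"] by linarith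
  finally show False by simp
qed

text \<open>The search starts at \<open>max k (\<tau> (2 * k + 1))\<close>, so that all \<open>y i\<close> with \<open>i \<le> k\<close> are already present and the
  maximisation error is at most half the tolerance. The remaining summand of \<open>Phi\<close> is the length of a block
  that must contain a step of energy at most \<open>d\<^sup>2\<close>. Such a step makes both \<open>f (y n) (x n)\<close> and the
  displacement of \<open>x n\<close> under \<open>T\<close> at most of order \<open>d * \<sigma>\<close>.\<close>

lemma approx_solution_bound:
  assumes u: "u \<in> Omega f T y" and c: "(norm (x 0 - u))\<^sup>2 \<le> c"
    and L: "0 \<le> L" and rate: "nondecreasing_rate \<tau> \<epsilon>"
  shows "\<exists>n \<le> Phi a b M L c \<tau> k. x n \<in> approx_solutions k"
proof -
  define \<alpha> where "\<alpha> = alpha_const a b M"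
  define \<sigma> where "\<sigma> = real (sigma_const a b M L)"
  define C where "C = nat \<lceil>c * \<sigma> ^ 4 * 16 * (real k + 1) ^ 4\<rceil>"
  define h where "h = 1 / (real k + 1)"
  define d where "d = 1 / (4 * \<sigma>\<^sup>2 * (real k + 1)\<^sup>2)"
  have \<alpha>: "\<alpha> > 0" unfolding \<alpha>_def by (rule alpha_pos)
  have c0: "0 \<le> c" using zero_le_power2 c by (rule order_trans)
  have Mb: "M * b > 0" using M_pos b_pos by simp
  have "sqrt (2 * M * b * L) / root 4 \<alpha> \<ge> 0" using Mb L \<alpha> by simp
  then have \<sigma>_ge: "\<sigma> \<ge> (M * b + 1) / sqrt \<alpha> + 1"
    unfolding \<sigma>_def sigma_const_def \<alpha>_def[symmetric] by linarith
  have \<sigma>_ge': "\<sigma> \<ge> M * b / sqrt \<alpha> + 1" "\<sigma> \<ge> 1 / sqrt \<alpha>" and \<sigma>1: "\<sigma> \<ge> 1"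
    using \<sigma>_ge Mb \<alpha> by (auto simp: add_divide_distrib intro: order_trans[rotated])
  obtain n where n: "max k (\<tau> (2 * k + 1)) \<le> n" "n \<le> max k (\<tau> (2 * k + 1)) + (2 * C + 1)"
    and E: "\<alpha> * (v n)\<^sup>2 + (norm (z n - x (Suc n)))\<^sup>2 \<le> c / (real (2 * C + 1) + 1)"
    using small_energy_term[OF u c] unfolding \<alpha>_def by blast
  have "n \<le> Phi a b M L c \<tau> k" using n(2) by (simp add: Phi_def C_def \<sigma>_def)
  have h_pos: "h > 0" by (simp add: h_def)
  \<comment> \<open>\<open>d\<close> is small enough for \<open>d * \<sigma> \<le> h / 4\<close>, and \<open>c / d\<^sup>2\<close> is the real number
    that \<open>C\<close> rounds up; the latter accounts for the squares of \<open>\<sigma>\<close> and \<open>k + 1\<close>.\<close>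
  have d_pos: "d > 0" using \<sigma>1 unfolding d_def by simp
  have d2: "d\<^sup>2 = 1 / (16 * \<sigma> ^ 4 * (real k + 1) ^ 4)"
    unfolding d_def by (simp add: power_divide power_mult_distrib flip: power_mult)
  have "c * \<sigma> ^ 4 * 16 * (real k + 1) ^ 4 \<le> real C" unfolding C_def by linarith
  then have "c \<le> d\<^sup>2 * real C" unfolding d2 using \<sigma>1 by (simp add: field_simps)
  also have "\<dots> \<le> d\<^sup>2 * (real (2 * C + 1) + 1)" by (intro mult_left_mono) auto
  finally have "c / (real (2 * C + 1) + 1) \<le> d\<^sup>2" by (simp add: divide_le_eq)
  with E have E': "\<alpha> * (v n)\<^sup>2 + (norm (z n - x (Suc n)))\<^sup>2 \<le> d\<^sup>2" by linarith
  have "(sqrt \<alpha> * v n)\<^sup>2 \<le> d\<^sup>2"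
    using E' \<alpha> zero_le_power2[of "norm (z n - x (Suc n))"]
    unfolding power_mult_distrib real_sqrt_pow2[OF less_imp_le[OF \<alpha>]] by linarith
  then have "sqrt \<alpha> * v n \<le> d" using less_imp_le[OF d_pos] by (rule power2_le_imp_le)
  then have v: "v n \<le> d / sqrt \<alpha>"
    using pos_le_divide_eq[of "sqrt \<alpha>" "v n" d] \<alpha> by (simp only: mult.commute real_sqrt_gt_0_iff)
  have "(norm (z n - x (Suc n)))\<^sup>2 \<le> d\<^sup>2"
    using E' mult_nonneg_nonneg[OF less_imp_le[OF \<alpha>] zero_le_power2[of "v n"]] by linarith
  then have r: "norm (z n - x (Suc n)) \<le> d" using less_imp_le[OF d_pos] by (rule power2_le_imp_le)
  have d\<sigma>: "d * \<sigma> \<le> h / 4"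
  proof -
    have "d * \<sigma> = h / 4 * (1 / (\<sigma> * (real k + 1)))"
      unfolding d_def h_def using \<sigma>1 by (simp add: power2_eq_square)
    also have "\<dots> \<le> h / 4 * 1"
      using mult_mono[of 1 \<sigma> 1 "real k + 1"] \<sigma>1 h_pos by (intro mult_left_mono) auto
    finally show ?thesis by simp
  qed
  have "v n \<le> d * \<sigma>" using v mult_left_mono[OF \<sigma>_ge'(2), of d] d_pos by simp
  then have v': "v n \<le> h / 4" using d\<sigma> by linarith
  have \<epsilon>: "\<epsilon> n \<le> h / 2"
  proof -
    have "\<epsilon> n \<le> 1 / (real (2 * k + 1) + 1)"
      using rate n(1) unfolding nondecreasing_rate_def by (meson max.boundedE)
    then show ?thesis by (simp add: h_def algebra_simps)
  qed
  have "f (y i) (x n) \<le> h" if "i \<le> k" for i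
  proof -
    have "f (y i) (x n) \<le> v n + \<epsilon> n" using that n(1) by (intro value_at_earlier_point) simp
    then show ?thesis using v' \<epsilon> h_pos by linarith
  qed
  moreover have "norm (x n - T (x n)) \<le> h"
  proof -
    have "norm (x n - z n) = lam n * v n * norm (\<xi> n)"
      using value_nonneg[of n] a_pos lam_ge[of n] by (simp add: abs_mult)
    also have "\<dots> \<le> b * (d / sqrt \<alpha>) * M"
      using v value_nonneg[of n] a_pos lam_ge[of n] lam_le[of n] \<xi>_le[of n] M_pos b_pos
      by (intro mult_mono mult_nonneg_nonneg) auto
    also have "\<dots> = d * (M * b / sqrt \<alpha>)" by (simp add: algebra_simps)
    finally have xz: "norm (x n - z n) \<le> d * (M * b / sqrt \<alpha>)" .
    have "x n - T (x n) = (x n - z n) + (z n - x (Suc n)) + (T (z n) - T (x n))" by (simp add: x_Suc)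
    then have "norm (x n - T (x n)) \<le> norm (x n - z n) + norm (z n - x (Suc n)) + norm (T (z n) - T (x n))"
      using norm_triangle_ineq[of "(x n - z n) + (z n - x (Suc n))" "T (z n) - T (x n)"]
        norm_triangle_ineq[of "x n - z n" "z n - x (Suc n)"] by simp
    also have "\<dots> \<le> d * (M * b / sqrt \<alpha>) + d + d * (M * b / sqrt \<alpha>)"
      using xz r firmly_nonexpansive_imp_nonexpansive[OF T, of "z n" "x n"]
      by (intro add_mono) (auto simp: norm_minus_commute)
    also have "\<dots> \<le> 2 * (d * (M * b / sqrt \<alpha> + 1))" using d_pos by (simp add: algebra_simps)
    also have "\<dots> \<le> 2 * (d * \<sigma>)" using mult_left_mono[OF \<sigma>_ge'(1), of d] d_pos by simp
    finally show ?thesis using d\<sigma> h_pos by linarith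
  qed
  ultimately have "x n \<in> approx_solutions k" by (simp add: approx_solutions_def h_def)
  with \<open>n \<le> Phi a b M L c \<tau> k\<close> show ?thesis by blast
qed

text \<open>The square root arises since \<open>subgradient_step\<close> bounds the increase of the squared distance only, and
  the distance itself may be small.\<close>

lemma distance_increase:
  assumes "norm (q - T q) \<le> \<delta>" "f (y n) q \<le> \<delta>" "0 \<le> \<delta>"
  shows "norm (x (Suc n) - q) \<le> norm (x n - q) + sqrt (2 * b * e * \<delta>) + \<delta>"
proof -
  have "lam n * M\<^sup>2 \<le> 2" using bM mult_right_mono[OF lam_le[of n], of "M\<^sup>2"] by simp
  then have "0 \<le> lam n * (2 - lam n * M\<^sup>2) * (v n)\<^sup>2" using a_pos lam_ge[of n] by simp
  moreover have "lam n * v n \<le> b * e"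
    using a_pos lam_ge[of n] lam_le[of n] value_nonneg[of n] value_le[of n] by (intro mult_mono) auto
  then have "2 * lam n * \<delta> * v n \<le> 2 * b * e * \<delta>"
    using mult_right_mono[of "lam n * v n" "b * e" \<delta>] assms(3) by (simp add: mult_ac)
  ultimately have "(norm (z n - q))\<^sup>2 \<le> (norm (x n - q))\<^sup>2 + 2 * b * e * \<delta>"
    using subgradient_step[OF subgradient \<xi>_le value_nonneg assms(2), of "lam n"] a_pos lam_ge[of n]
    by simp
  then have "norm (z n - q) \<le> sqrt ((norm (x n - q))\<^sup>2 + 2 * b * e * \<delta>)" by (rule real_le_rsqrt)
  also have "\<dots> \<le> sqrt ((norm (x n - q))\<^sup>2) + sqrt (2 * b * e * \<delta>)"
    using b_pos e_nonneg assms(3) by (intro sqrt_add_le_add_sqrt) auto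
  finally have zq: "norm (z n - q) \<le> norm (x n - q) + sqrt (2 * b * e * \<delta>)" by simp
  have "norm (x (Suc n) - q) \<le> norm (T (z n) - T q) + norm (T q - q)"
    unfolding x_Suc using norm_triangle_ineq[of "T (z n) - T q" "T q - q"] by simp
  also have "\<dots> \<le> norm (z n - q) + \<delta>"
    using firmly_nonexpansive_imp_nonexpansive[OF T, of "z n" q] assms(1)
    by (simp add: norm_minus_commute add_mono)
  finally show ?thesis using zq by linarith
qed

text \<open>The increases of at most \<open>m\<close> steps add up. As \<open>\<delta> \<le> 1\<close>, each is at most \<open>sqrt (beta_const b e M * \<delta>)\<close>, so \<open>\<delta>\<close>
  must be of the order of \<open>1 / ((r + 1)\<^sup>2 * m\<^sup>2 * beta_const b e M)\<close>; the part \<open>n + m\<close> of \<open>chi\<close>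
  ensures that \<open>f (y l) q\<close> is controlled at every step \<open>l\<close> involved.\<close>

lemma Fejer_modulus:
  assumes q: "q \<in> approx_solutions (chi b e M n m r)" and i: "i \<in> {n..n + m}"
  shows "dist (x i) q \<le> dist (x n) q + 1 / (real r + 1)"
proof -
  define N where "N = chi b e M n m r"
  define \<delta> where "\<delta> = 1 / (real N + 1)"
  define s where "s = sqrt (2 * b * e * \<delta>) + \<delta>"
  have \<delta>: "0 < \<delta>" "\<delta> \<le> 1" by (simp_all add: \<delta>_def)
  have be: "0 \<le> b * e" using b_pos e_nonneg by simp
  have s_nonneg: "0 \<le> s" using \<delta> be by (simp add: s_def)
  have step: "norm (x (Suc l) - q) \<le> norm (x l - q) + s" if "l \<le> N" for l
    using distance_increase[of q \<delta> l] q that \<delta>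
    by (simp add: s_def \<delta>_def N_def approx_solutions_def)
  have "n + m \<le> N" by (simp add: N_def chi_def)
  then have iter: "norm (x (n + j) - q) \<le> norm (x n - q) + real j * s" if "j \<le> m" for j
    using that
  proof (induction j)
    case (Suc j)
    then show ?case using step[of "n + j"] by (simp add: algebra_simps)
  qed simp
  define B where "B = sqrt (beta_const b e M)"
  have be': "0 \<le> 2 * b * e * (1 + M)" using be M_pos by simp
  then have B: "B = 1 + sqrt (2 * b * e * (1 + M))" by (simp add: B_def beta_const_def)
  have "sqrt (2 * b * e) \<le> sqrt (2 * b * e * (1 + M))"
    using mult_left_mono[of 1 "1 + M" "2 * b * e"] be M_pos by simp
  moreover have "\<delta> \<le> sqrt \<delta>" using \<delta> by (intro real_le_rsqrt) (simp add: power2_eq_square mult_left_le)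
  ultimately have "s \<le> B * sqrt \<delta>"
    using mult_right_mono[of "sqrt (2 * b * e)" "sqrt (2 * b * e * (1 + M))" "sqrt \<delta>"] \<delta>
    unfolding s_def B real_sqrt_mult[of "2 * b * e" \<delta>] distrib_right by linarith
  then have "real m * s \<le> real m * (B * sqrt \<delta>)" by (rule mult_left_mono) simp
  also have "\<dots> \<le> 1 / (real r + 1)"
  proof -
    have "(real r + 1)\<^sup>2 * (real m)\<^sup>2 * beta_const b e M \<le> real N + 1"
      unfolding N_def chi_def by linarith
    then have "((real r + 1) * real m * B)\<^sup>2 * \<delta> \<le> 1"
      unfolding \<delta>_def by (simp add: power_mult_distrib B_def beta_const_def)
    then have "((real r + 1) * real m * B * sqrt \<delta>)\<^sup>2 \<le> 1\<^sup>2"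
      using \<delta> by (simp add: power_mult_distrib)
    then have "(real r + 1) * real m * B * sqrt \<delta> \<le> 1" by (rule power2_le_imp_le) simp
    then show ?thesis by (simp add: field_simps)
  qed
  finally have ms: "real m * s \<le> 1 / (real r + 1)" .
  obtain j where j: "i = n + j" "j \<le> m" using i by (auto simp: le_iff_add)
  have "real j * s \<le> real m * s" using j(2) s_nonneg by (intro mult_right_mono) auto
  then show ?thesis using iter[OF j(2)] ms j(1) by (simp add: dist_norm)
qed

end

theorem theorem17:
  fixes f :: "real ^ 'n \<Rightarrow> real ^ 'n \<Rightarrow> real"
    and T :: "real ^ 'n \<Rightarrow> real ^ 'n"
    and x y \<xi> :: "nat \<Rightarrow> real ^ 'n"
    and \<epsilon> lam \<rho> :: "nat \<Rightarrow> real"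
    and e M a b L c\<^sub>u :: real
    and \<tau> :: "nat \<Rightarrow> nat"
    and u :: "real ^ 'n"
  assumes "equilibrium_bifunction f"
    and "firmly_nonexpansive T"
    and "Fixpoints T \<noteq> {}"
    and "generated_by_algorithm f T \<epsilon> lam x \<rho> y \<xi>"
    and "\<And>n. f (y n) (x n) \<le> e"
    and "M > 0"
    and "\<And>n. norm (\<xi> n) \<le> M"
    and "{a..b} \<subseteq> {0<..<2 / M\<^sup>2}"
    and "\<And>n. lam n \<in> {a..b}"
    and "bounded (range x)"
    and "diameter (range x) \<le> L"
    and "\<epsilon> \<longlonglongrightarrow> 0"
    and "nondecreasing_rate \<tau> \<epsilon>"
    and "u \<in> Omega f T y"
    and "(norm (x 0 - u))\<^sup>2 \<le> c\<^sub>u"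
  shows "\<forall>(k::nat) (g::nat \<Rightarrow> nat).
           \<exists>n \<le> Sigma0 (P_bound CARD('n) L k) k g (chi b e M) (Phi a b M L c\<^sub>u \<tau>).
             \<forall>i\<in>{n..n + g n}. \<forall>j\<in>{n..n + g n}. norm (x i - x j) \<le> 1 / (real k + 1)"
proof (intro allI)
  fix k :: nat and g :: "nat \<Rightarrow> nat"
  have lam: "a \<le> lam n" "lam n \<le> b" for n using assms(9)[of n] by auto
  have "a \<le> b" using lam[of 0] by simp
  then have ab: "a > 0" "b < 2 / M\<^sup>2" using assms(8) by auto
  interpret algorithm_run f T \<epsilon> lam \<rho> x y \<xi> a b e M
    using assms lam ab by unfold_locales
  have dist_le: "dist (x i) (x j) \<le> L" for i j
    using diameter_bounded_bound[OF assms(10), of "x i" "x j"] assms(11) by simp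
  have L: "0 \<le> L" using dist_le[of 0 0] by simp
  show "\<exists>n \<le> Sigma0 (P_bound CARD('n) L k) k g (chi b e M) (Phi a b M L c\<^sub>u \<tau>).
             \<forall>i\<in>{n..n + g n}. \<forall>j\<in>{n..n + g n}. norm (x i - x j) \<le> 1 / (real k + 1)"
  \<comment> \<open>For \<open>L = 0\<close> there are no cells at all, so the pigeonhole argument is void, but \<open>x\<close> is constant.\<close>
  proof (cases "L = 0")
    case True
    then have "norm (x i - x j) \<le> 1 / (real k + 1)" for i j
      using dist_le[of i j] by (simp add: dist_norm)
    then show ?thesis by blast
  next
    case False
    have P: "P_bound CARD('n) L k = nat \<lceil>2 * sqrt CARD('n) * L / (1 / (4 * real k + 4))\<rceil> ^ CARD('n)"
      by (simp add: P_bound_def algebra_simps)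
    have close: "\<exists>s t. s < t \<and> t \<le> P_bound CARD('n) L k \<and> dist (p s) (p t) \<le> 1 / (4 * real k + 4)"
      if "range p \<subseteq> range x" for p :: "nat \<Rightarrow> real ^ 'n"
    proof -
      have "dist (p s) (p t) \<le> L" for s t
        using that dist_le by (metis image_subset_iff imageE UNIV_I)
      then show ?thesis unfolding P using L False by (intro two_points_close) auto
    qed
    show ?thesis unfolding dist_norm[symmetric]
    proof (rule metastable_if_approximately_Fejer_monotone[where A = approx_solutions])
      show "approx_solutions m \<subseteq> approx_solutions j" if "j \<le> m" for j m
        using approx_solutions_antimono that .
      show "\<exists>n \<le> Phi a b M L c\<^sub>u \<tau> j. x n \<in> approx_solutions j" for j
        using approx_solution_bound[OF assms(14,15) L assms(13)] .
      show "dist (x i) q \<le> dist (x n) q + 1 / (real r + 1)"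
        if "q \<in> approx_solutions (chi b e M n m r)" "i \<in> {n..n + m}" for n m r q i
        using Fejer_modulus that .
      show "j \<le> chi b e M j m r" for j m r by (simp add: chi_def)
      show "j \<le> Phi a b M L c\<^sub>u \<tau> j" for j by (simp add: Phi_def)
    qed (rule close)
  qed
qed

end
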